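(* Let $\vec U=\vec\phi+\vec\psi$ with $\phi^i=\partial_i\tilde\phi$ for a scalar function $\tilde\phi$ and $\mathrm{div}\,\vec\psi=0$, and suppose that $$(\partial_t^2\phi^i-c_1^2\Delta\phi^i)+(\partial_t^2\psi^i-c_2^2\Delta\psi^i)=\sum_{j,k=1}^3G'(\partial_j\phi^k+\partial_j\psi^k)\,(\partial_i\partial_j\phi^k+\partial_i\partial_j\psi^k),\qquad i=1,2,3.$$ Then, taking the divergence and the curl of this equation, one obtains $$\hat\square_{\mathbf g_E(\partial\vec\phi,\partial\vec\psi)}(\mathrm{div}\vec\phi)=P_{(\mathrm{div}\vec\phi)}(\partial^2\vec\phi,\partial^3\vec\psi),\qquad \square_{\mathbf h_E}(\mathrm{curl}\vec\psi)^i=0,$$ where $$\mathbf g_E^{-1}=-\partial_t\otimes\partial_t+\sum_{j,k=1}^3\Big\{\delta^{jk}c_1^2+\tfrac12G'(\partial_j\phi^k+\partial_j\psi^k)+\tfrac12G'(\partial_k\phi^j+\partial_k\psi^j)\Big\}\partial_j\otimes\partial_k,\qquad \mathbf h_E^{-1}=-\partial_t\otimes\partial_t+c_2^2\sum_{a=1}^3\partial_a\otimes\partial_a,$$ $$P_{(\mathrm{div}\vec\phi)}=-\sum_{j,k=1}^3G'(\partial_j\phi^k+\partial_j\psi^k)\,\Delta\partial_j\psi^k-\sum_{i,j,k=1}^3G''(\partial_j\phi^k+\partial_j\psi^k)\,(\partial_i\partial_j\phi^k+\partial_i\partial_j\psi^k)^2 .$$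
   Context: $c_1>c_2>0$ are constants; all functions are smooth on $[0,T]\times\mathbb R^3$. $G$ is a smooth scalar function of $\partial\vec U=(\partial_jU^k)_{j,k}$; $G'(\partial_jU^k):=\partial G/\partial(\partial_jU^k)$ is, as in the paper, a smooth scalar function of $\partial_jU^k$ (for each $j,k$), and $G''(\partial_jU^k)$ denotes its derivative with respect to $\partial_jU^k$. Wave operators: $\square_{\mathbf g}\varphi=|\det\mathbf g|^{-1/2}\partial_\alpha(|\det\mathbf g|^{1/2}(\mathbf g^{-1})^{\alpha\beta}\partial_\beta\varphi)$ and $\hat\square_{\mathbf g}\varphi=(\mathbf g^{-1})^{\alpha\beta}\partial_\alpha\partial_\beta\varphi$, $x^0=t$. $\mathrm{div}\,\vec V=\partial_iV^i$, $(\mathrm{curl}\,\vec V)^i=\epsilon_{iab}\partial_aV^b$. *)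

theory Defs
  imports "HOL-Analysis.Analysis"
begin

text \<open>
  Derivatives are taken relative to the domain \<open>S\<close>, so on the faces \<open>t = 0\<close> and \<open>t = T\<close> of the
  slab they are one-sided in \<open>t\<close>. On a nondegenerate slab the derivative relative to the domain
  is unique.
\<close>

primrec Ck_on :: "nat \<Rightarrow> 'a::euclidean_space set \<Rightarrow> ('a \<Rightarrow> 'b::real_normed_vector) \<Rightarrow> bool" where
  "Ck_on 0 S f \<longleftrightarrow> continuous_on S f"
| "Ck_on (Suc k) S f \<longleftrightarrow> f differentiable_on S \<and>
     (\<forall>v. Ck_on k S (\<lambda>x. frechet_derivative f (at x within S) v))"

definition smooth_on :: "'a::euclidean_space set \<Rightarrow> ('a \<Rightarrow> 'b::real_normed_vector) \<Rightarrow> bool" where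
  "smooth_on S f \<longleftrightarrow> (\<forall>k. Ck_on k S f)"

type_synonym point = "real \<times> (real ^ 3)"

text \<open>
  Spacetime indices \<open>\<alpha> = 0, 1, 2, 3\<close>: the time index \<open>0\<close> is \<open>None\<close>, the space index \<open>j\<close> is \<open>Some j\<close>.
\<close>

type_synonym st_index = "3 option"

definition slab :: "real \<Rightarrow> point set" where
  "slab T = {0..T} \<times> UNIV"

fun coord_vec :: "st_index \<Rightarrow> point" where
  "coord_vec None = (1, 0)"
| "coord_vec (Some j) = (0, axis j 1)"

definition pd :: "real \<Rightarrow> st_index \<Rightarrow> (point \<Rightarrow> real) \<Rightarrow> point \<Rightarrow> real" where
  "pd T \<alpha> f p = frechet_derivative f (at p within slab T) (coord_vec \<alpha>)"

abbreviation dt :: "real \<Rightarrow> (point \<Rightarrow> real) \<Rightarrow> point \<Rightarrow> real" where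
  "dt T \<equiv> pd T None"

abbreviation dx :: "real \<Rightarrow> 3 \<Rightarrow> (point \<Rightarrow> real) \<Rightarrow> point \<Rightarrow> real" where
  "dx T j \<equiv> pd T (Some j)"

abbreviation cmp :: "(point \<Rightarrow> real ^ 3) \<Rightarrow> 3 \<Rightarrow> point \<Rightarrow> real" where
  "cmp V i \<equiv> (\<lambda>p. V p $ i)"

definition laplacian :: "real \<Rightarrow> (point \<Rightarrow> real) \<Rightarrow> point \<Rightarrow> real" where
  "laplacian T f p = (\<Sum>a\<in>UNIV. dx T a (dx T a f) p)"

definition divergence :: "real \<Rightarrow> (point \<Rightarrow> real ^ 3) \<Rightarrow> point \<Rightarrow> real" where
  "divergence T V p = (\<Sum>i\<in>UNIV. dx T i (cmp V i) p)"

definition levi_civita :: "3 \<Rightarrow> 3 \<Rightarrow> 3 \<Rightarrow> real" where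
  "levi_civita i a b =
     (if (i, a, b) \<in> {(1, 2, 3), (2, 3, 1), (3, 1, 2)} then 1
      else if (i, a, b) \<in> {(3, 2, 1), (2, 1, 3), (1, 3, 2)} then -1 else 0)"

definition curl :: "real \<Rightarrow> (point \<Rightarrow> real ^ 3) \<Rightarrow> point \<Rightarrow> real ^ 3" where
  "curl T V p = (\<chi> i. \<Sum>a\<in>UNIV. \<Sum>b\<in>UNIV. levi_civita i a b * dx T a (cmp V b) p)"

text \<open>
  Both wave operators take the inverse metric \<open>ginv = g\<^sup>-\<^sup>1\<close> as argument, since the metrics of
  interest are given through their inverses; the metric itself is \<open>matrix_inv (ginv p)\<close>.
\<close>

type_synonym inv_metric = "point \<Rightarrow> real ^ st_index ^ st_index"

definition hat_wave_op :: "real \<Rightarrow> inv_metric \<Rightarrow> (point \<Rightarrow> real) \<Rightarrow> point \<Rightarrow> real" where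
  "hat_wave_op T ginv f p = (\<Sum>\<alpha>\<in>UNIV. \<Sum>\<beta>\<in>UNIV. ginv p $ \<alpha> $ \<beta> * pd T \<alpha> (pd T \<beta> f) p)"

definition abs_det_metric :: "inv_metric \<Rightarrow> point \<Rightarrow> real" where
  "abs_det_metric ginv p = \<bar>det (matrix_inv (ginv p))\<bar>"

definition wave_op :: "real \<Rightarrow> inv_metric \<Rightarrow> (point \<Rightarrow> real) \<Rightarrow> point \<Rightarrow> real" where
  "wave_op T ginv f p = 1 / sqrt (abs_det_metric ginv p) *
     (\<Sum>\<alpha>\<in>UNIV. pd T \<alpha>
        (\<lambda>q. sqrt (abs_det_metric ginv q) * (\<Sum>\<beta>\<in>UNIV. ginv q $ \<alpha> $ \<beta> * pd T \<beta> f q)) p)"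

text \<open>
  Below, \<open>G' j k\<close> is the one-variable function \<open>G'(\<partial>\<^sub>j U\<^sup>k)\<close>, the partial derivative of \<open>G\<close>
  with respect to its argument \<open>\<partial>\<^sub>j U\<^sup>k\<close>, and \<open>dU T \<phi> \<psi> j k\<close> is \<open>\<partial>\<^sub>j U\<^sup>k = \<partial>\<^sub>j \<phi>\<^sup>k + \<partial>\<^sub>j \<psi>\<^sup>k\<close>.
\<close>

definition dU :: "real \<Rightarrow> (point \<Rightarrow> real ^ 3) \<Rightarrow> (point \<Rightarrow> real ^ 3) \<Rightarrow> 3 \<Rightarrow> 3 \<Rightarrow> point \<Rightarrow> real" where
  "dU T \<phi> \<psi> j k p = dx T j (cmp \<phi> k) p + dx T j (cmp \<psi> k) p"

definition gE_inv ::
  "real \<Rightarrow> real \<Rightarrow> (3 \<Rightarrow> 3 \<Rightarrow> real \<Rightarrow> real) \<Rightarrow> (point \<Rightarrow> real ^ 3) \<Rightarrow> (point \<Rightarrow> real ^ 3) \<Rightarrow> inv_metric"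
  where
  "gE_inv T c\<^sub>1 G' \<phi> \<psi> p = (\<chi> \<alpha> \<beta>. case (\<alpha>, \<beta>) of
       (None, None) \<Rightarrow> -1
     | (Some j, Some k) \<Rightarrow> (if j = k then c\<^sub>1\<^sup>2 else 0)
          + 1/2 * G' j k (dU T \<phi> \<psi> j k p) + 1/2 * G' k j (dU T \<phi> \<psi> k j p)
     | _ \<Rightarrow> 0)"

definition hE_inv :: "real \<Rightarrow> inv_metric" where
  "hE_inv c\<^sub>2 p = (\<chi> \<alpha> \<beta>. case (\<alpha>, \<beta>) of
       (None, None) \<Rightarrow> -1
     | (Some a, Some b) \<Rightarrow> (if a = b then c\<^sub>2\<^sup>2 else 0)
     | _ \<Rightarrow> 0)"

definition P_div ::
  "real \<Rightarrow> (3 \<Rightarrow> 3 \<Rightarrow> real \<Rightarrow> real) \<Rightarrow> (point \<Rightarrow> real ^ 3) \<Rightarrow> (point \<Rightarrow> real ^ 3) \<Rightarrow> point \<Rightarrow> real"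
  where
  "P_div T G' \<phi> \<psi> p =
     - (\<Sum>j\<in>UNIV. \<Sum>k\<in>UNIV. G' j k (dU T \<phi> \<psi> j k p) * laplacian T (dx T j (cmp \<psi> k)) p)
     - (\<Sum>i\<in>UNIV. \<Sum>j\<in>UNIV. \<Sum>k\<in>UNIV. deriv (G' j k) (dU T \<phi> \<psi> j k p) *
          (dx T i (dx T j (cmp \<phi> k)) p + dx T i (dx T j (cmp \<psi> k)) p)\<^sup>2)"

end

theory Submission
  imports Defs
begin

text \<open>
  Write \<open>\<box>\<^sub>c f\<close> for \<open>\<partial>\<^sub>t\<^sup>2 f - c\<^sup>2 \<Delta> f\<close> and \<open>U = \<phi> + \<psi>\<close>. Applying \<open>\<partial>\<^sub>a\<close> to the \<open>i\<close>-th component of the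
  equation and commuting it with \<open>\<box>\<^sub>c\<close> gives (lemma \<open>differentiated_wave_equation\<close>)
    \<open>\<box>\<^bsub>c1\<^esub> \<partial>\<^sub>a\<phi>\<^sup>i + \<box>\<^bsub>c2\<^esub> \<partial>\<^sub>a\<psi>\<^sup>i
       = \<Sum>j k. G''(\<partial>\<^sub>jU\<^sup>k) \<partial>\<^sub>a\<partial>\<^sub>jU\<^sup>k \<partial>\<^sub>i\<partial>\<^sub>jU\<^sup>k + G'(\<partial>\<^sub>jU\<^sup>k) \<partial>\<^sub>a\<partial>\<^sub>i\<partial>\<^sub>jU\<^sup>k\<close>,
  and both claims are read off from this one identity.

  For the curl: the right-hand side is symmetric in \<open>a\<close> and \<open>i\<close>, because the nonlinearity is itself the
  gradient of a function of \<open>\<partial>U\<close>; and \<open>\<partial>\<^sub>a\<phi>\<^sup>i\<close> is symmetric because \<open>\<phi>\<close> is a gradient. Hence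
  \<open>\<box>\<^bsub>c2\<^esub> \<partial>\<^sub>a\<psi>\<^sup>i\<close> is symmetric, and contracting it with the Levi-Civita symbol gives
  \<open>\<box>\<^bsub>c2\<^esub> (curl \<psi>) = 0\<close>. The metric \<open>h\<^sub>E\<close> is constant, so the volume factors in its geometric wave operator
  cancel and leave \<open>- \<box>\<^bsub>c2\<^esub>\<close>.

  For the divergence: put \<open>a = i\<close> and sum. The term with \<open>\<psi>\<close> on the left is \<open>\<box>\<^bsub>c2\<^esub> (div \<psi>) = 0\<close>. On the right,
  \<open>\<Delta>\<partial>\<^sub>j\<phi>\<^sup>k = \<partial>\<^sub>j\<partial>\<^sub>k div \<phi>\<close>, again since \<open>\<phi>\<close> is a gradient, so these terms are the quasilinear
  part of the wave operator of \<open>g\<^sub>E\<close>; symmetrising its coefficient in \<open>j, k\<close> changes nothing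
  because second derivatives commute. What is left over is \<open>P_div\<close>.

  The analytic input is the calculus of derivatives relative to the closed slab, above all the
  symmetry of second derivatives up to the faces \<open>t = 0\<close> and \<open>t = T\<close>.
\<close>

section \<open>Smooth functions and their iterated derivatives\<close>

lemma smooth_on_frechet_derivative:
  assumes "smooth_on S f"
  shows "smooth_on S (\<lambda>x. frechet_derivative f (at x within S) v)"
  using assms unfolding smooth_on_def by (metis Ck_on.simps(2))

lemma smooth_on_imp_differentiable_on:
  assumes "smooth_on S f"
  shows "f differentiable_on S"
  using assms unfolding smooth_on_def by (metis Ck_on.simps(2))

lemma smooth_on_imp_has_derivative:
  assumes "smooth_on S f" "x \<in> S"
  shows "(f has_derivative frechet_derivative f (at x within S)) (at x within S)"
  using smooth_on_imp_differentiable_on[OF assms(1)] assms(2)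
  by (simp add: differentiable_on_def frechet_derivative_works)

lemma smooth_on_imp_continuous_on:
  assumes "smooth_on S f"
  shows "continuous_on S f"
  using assms unfolding smooth_on_def by (metis Ck_on.simps(1))

lemma has_derivative_within_cong:
  assumes "\<And>y. y \<in> S \<Longrightarrow> f y = g y" "x \<in> S"
  shows "(f has_derivative D) (at x within S) \<longleftrightarrow> (g has_derivative D) (at x within S)"
  using assms has_derivative_transform by metis

lemma frechet_derivative_within_cong:
  assumes "\<And>y. y \<in> S \<Longrightarrow> f y = g y" "x \<in> S"
  shows "frechet_derivative f (at x within S) = frechet_derivative g (at x within S)"
  unfolding frechet_derivative_def using has_derivative_within_cong[OF assms] by simp

lemma Ck_on_cong:
  assumes "\<And>y. y \<in> S \<Longrightarrow> f y = g y"
  shows "Ck_on k S f \<longleftrightarrow> Ck_on k S g"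
  using assms
proof (induction k arbitrary: f g)
  case 0
  then show ?case by (simp cong: continuous_on_cong)
next
  case (Suc k)
  have "f differentiable_on S \<longleftrightarrow> g differentiable_on S"
    unfolding differentiable_on_def differentiable_def
    using has_derivative_within_cong[of S f g] Suc.prems by blast
  moreover have "Ck_on k S (\<lambda>x. frechet_derivative f (at x within S) v)
      \<longleftrightarrow> Ck_on k S (\<lambda>x. frechet_derivative g (at x within S) v)" for v
    by (rule Suc.IH) (use frechet_derivative_within_cong[of S f g] Suc.prems in auto)
  ultimately show ?case by simp
qed

section \<open>Symmetry of second derivatives at a corner\<close>

lemma has_derivative_along_line:
  fixes F :: "'a::real_normed_vector \<Rightarrow> real"
  assumes "\<And>x. x \<in> S \<Longrightarrow> (F has_derivative F' x) (at x within S)"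
    and "\<And>s. s \<in> {0..h} \<Longrightarrow> x + s *\<^sub>R v \<in> S" and "s \<in> {0..h}"
  shows "((\<lambda>s. F (x + s *\<^sub>R v)) has_derivative (\<lambda>r. r * F' (x + s *\<^sub>R v) v)) (at s within {0..h})"
proof -
  have F': "(F has_derivative F' (x + s *\<^sub>R v)) (at (x + s *\<^sub>R v) within S)"
    using assms by blast
  have "((\<lambda>s. F (x + s *\<^sub>R v)) has_derivative (\<lambda>r. F' (x + s *\<^sub>R v) (r *\<^sub>R v))) (at s within {0..h})"
    by (rule has_derivative_in_compose[where g = F])
       (auto intro!: derivative_eq_intros has_derivative_subset[OF F'] assms(2))
  then show ?thesis
    using has_derivative_linear[OF F'] by (simp add: linear_cmul)
qed

text \<open>
  The mean value theorem applied once along \<open>v\<close> and once along \<open>w\<close>. Only the parallelogram spanned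
  at \<open>p\<close> is required to lie in \<open>S\<close>, so \<open>p\<close> may be a boundary point.
\<close>

lemma second_difference_eq_mixed_derivative:
  fixes f :: "'a::real_normed_vector \<Rightarrow> real"
  assumes f': "\<And>x. x \<in> S \<Longrightarrow> (f has_derivative f' x) (at x within S)"
    and Dv: "\<And>x. x \<in> S \<Longrightarrow> ((\<lambda>x. f' x v) has_derivative Dv x) (at x within S)"
    and S: "\<And>s t. s \<in> {0..h} \<Longrightarrow> t \<in> {0..h} \<Longrightarrow> p + s *\<^sub>R v + t *\<^sub>R w \<in> S"
    and h: "h > 0"
  shows "\<exists>s\<in>{0..h}. \<exists>t\<in>{0..h}. f (p + h *\<^sub>R v + h *\<^sub>R w) - f (p + h *\<^sub>R v) - f (p + h *\<^sub>R w) + f p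
           = h * h * Dv (p + s *\<^sub>R v + t *\<^sub>R w) w"
proof -
  have line: "((\<lambda>s. f (p + t *\<^sub>R w + s *\<^sub>R v)) has_derivative (\<lambda>r. r * f' (p + t *\<^sub>R w + s *\<^sub>R v) v))
      (at s within {0..h})" if "s \<in> {0..h}" "t \<in> {0..h}" for s t
    by (rule has_derivative_along_line[OF f' _ that(1)])
       (use S that(2) in \<open>auto simp: algebra_simps\<close>)
  have "\<exists>s\<in>{0<..<h}. (f (p + h *\<^sub>R w + h *\<^sub>R v) - f (p + 0 *\<^sub>R w + h *\<^sub>R v))
      - (f (p + h *\<^sub>R w + 0 *\<^sub>R v) - f (p + 0 *\<^sub>R w + 0 *\<^sub>R v))
      = (h - 0) * f' (p + h *\<^sub>R w + s *\<^sub>R v) v - (h - 0) * f' (p + 0 *\<^sub>R w + s *\<^sub>R v) v"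
    by (rule mvt_simple[OF h, of "\<lambda>s. f (p + h *\<^sub>R w + s *\<^sub>R v) - f (p + 0 *\<^sub>R w + s *\<^sub>R v)"],
        rule has_derivative_diff) (use h line[of _ h] line[of _ 0] in simp_all)
  then obtain s where s0: "s \<in> {0<..<h}"
    and "(f (p + h *\<^sub>R w + h *\<^sub>R v) - f (p + h *\<^sub>R v)) - (f (p + h *\<^sub>R w) - f p)
      = h * f' (p + h *\<^sub>R w + s *\<^sub>R v) v - h * f' (p + s *\<^sub>R v) v"
    by auto
  then have s_eq: "f (p + h *\<^sub>R v + h *\<^sub>R w) - f (p + h *\<^sub>R v) - f (p + h *\<^sub>R w) + f p
      = h * (f' (p + s *\<^sub>R v + h *\<^sub>R w) v - f' (p + s *\<^sub>R v) v)"
    by (simp add: algebra_simps)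
  have s: "s \<in> {0..h}" using s0 by simp
  have "\<exists>t\<in>{0<..<h}. f' (p + s *\<^sub>R v + h *\<^sub>R w) v - f' (p + s *\<^sub>R v + 0 *\<^sub>R w) v
      = (h - 0) * Dv (p + s *\<^sub>R v + t *\<^sub>R w) w"
    by (rule mvt_simple[OF h, of "\<lambda>t. f' (p + s *\<^sub>R v + t *\<^sub>R w) v"],
        rule has_derivative_along_line[where F = "\<lambda>x. f' x v", OF Dv]) (use S s in auto)
  then obtain t where "t \<in> {0<..<h}"
    "f' (p + s *\<^sub>R v + h *\<^sub>R w) v - f' (p + s *\<^sub>R v) v = h * Dv (p + s *\<^sub>R v + t *\<^sub>R w) w"
    by auto
  then have "t \<in> {0..h}" "f (p + h *\<^sub>R v + h *\<^sub>R w) - f (p + h *\<^sub>R v) - f (p + h *\<^sub>R w) + f p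
      = h * h * Dv (p + s *\<^sub>R v + t *\<^sub>R w) w"
    using s_eq by simp_all
  with s show ?thesis by blast
qed

text \<open>
  The mean value theorem yields points somewhere in shrinking parallelograms at \<open>p\<close>; they converge
  to \<open>p\<close>.
\<close>

lemma tendsto_corner_point:
  fixes D :: "'a::real_normed_vector \<Rightarrow> real"
  assumes "continuous_on S D" "p \<in> S"
    and "\<And>n::nat. s n \<in> {0..\<delta> / Suc n}" "\<And>n. t n \<in> {0..\<delta> / Suc n}"
    and "\<And>n. p + s n *\<^sub>R v + t n *\<^sub>R w \<in> S"
  shows "(\<lambda>n. D (p + s n *\<^sub>R v + t n *\<^sub>R w)) \<longlonglongrightarrow> D p"
proof -
  have z: "(\<lambda>n. \<delta> / real (Suc n)) \<longlonglongrightarrow> 0"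
    by (rule LIMSEQ_Suc[OF lim_const_over_n])
  have "s \<longlonglongrightarrow> 0"
    by (rule tendsto_sandwich[OF _ _ tendsto_const z]) (use assms in auto)
  moreover have "t \<longlonglongrightarrow> 0"
    by (rule tendsto_sandwich[OF _ _ tendsto_const z]) (use assms in auto)
  ultimately have "(\<lambda>n. p + s n *\<^sub>R v + t n *\<^sub>R w) \<longlonglongrightarrow> p + 0 *\<^sub>R v + 0 *\<^sub>R w"
    by (intro tendsto_intros)
  then show ?thesis
    using assms by (auto intro: continuous_on_tendsto_compose)
qed

text \<open>
  The second difference of \<open>f\<close> over the parallelogram with sides \<open>h v\<close> and \<open>h w\<close> does not depend on
  the order of the two directions, so each mixed derivative takes, near \<open>p\<close>, a value that the
  other also takes near \<open>p\<close>. Continuity at \<open>p\<close> finishes the argument as \<open>h\<close> tends to \<open>0\<close>.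
\<close>

lemma second_derivatives_commute_at_corner:
  fixes f :: "'a::real_normed_vector \<Rightarrow> real"
  assumes f': "\<And>x. x \<in> S \<Longrightarrow> (f has_derivative f' x) (at x within S)"
    and Dv: "\<And>x. x \<in> S \<Longrightarrow> ((\<lambda>x. f' x v) has_derivative Dv x) (at x within S)"
    and Dw: "\<And>x. x \<in> S \<Longrightarrow> ((\<lambda>x. f' x w) has_derivative Dw x) (at x within S)"
    and cont: "continuous_on S (\<lambda>x. Dv x w)" "continuous_on S (\<lambda>x. Dw x v)"
    and S: "\<And>s t. s \<in> {0..\<delta>} \<Longrightarrow> t \<in> {0..\<delta>} \<Longrightarrow> p + s *\<^sub>R v + t *\<^sub>R w \<in> S"
    and \<delta>: "\<delta> > 0"
  shows "Dv p w = Dw p v"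
proof -
  have p: "p \<in> S" using S[of 0 0] \<delta> by simp
  have sub: "s \<in> {0..\<delta>}" if "s \<in> {0..\<delta> / real (Suc n)}" for s n
  proof -
    have "\<delta> / real (Suc n) \<le> \<delta>" using \<delta> by (simp add: field_simps)
    then show ?thesis using that by auto
  qed
  have "\<forall>n. \<exists>s t s' t'. s \<in> {0..\<delta> / Suc n} \<and> t \<in> {0..\<delta> / Suc n}
      \<and> s' \<in> {0..\<delta> / Suc n} \<and> t' \<in> {0..\<delta> / Suc n}
      \<and> Dv (p + s *\<^sub>R v + t *\<^sub>R w) w = Dw (p + s' *\<^sub>R v + t' *\<^sub>R w) v"
  proof
    fix n :: nat
    define h where "h = \<delta> / Suc n"
    have h: "h > 0" using \<delta> by (simp add: h_def)
    have S1: "p + s *\<^sub>R v + t *\<^sub>R w \<in> S" "p + t *\<^sub>R w + s *\<^sub>R v \<in> S"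
      if "s \<in> {0..h}" "t \<in> {0..h}" for s t
      using S[OF sub sub] that unfolding h_def by (force simp: algebra_simps)+
    obtain s t where st: "s \<in> {0..h}" "t \<in> {0..h}"
      "f (p + h *\<^sub>R v + h *\<^sub>R w) - f (p + h *\<^sub>R v) - f (p + h *\<^sub>R w) + f p
         = h * h * Dv (p + s *\<^sub>R v + t *\<^sub>R w) w"
      using second_difference_eq_mixed_derivative[of S f f' v Dv, OF f' Dv S1(1) h] by blast
    obtain t' s' where st': "t' \<in> {0..h}" "s' \<in> {0..h}"
      "f (p + h *\<^sub>R w + h *\<^sub>R v) - f (p + h *\<^sub>R w) - f (p + h *\<^sub>R v) + f p
         = h * h * Dw (p + t' *\<^sub>R w + s' *\<^sub>R v) v"
      using second_difference_eq_mixed_derivative[of S f f' w Dw, OF f' Dw S1(2) h] by blast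
    have "h * h * Dv (p + s *\<^sub>R v + t *\<^sub>R w) w = h * h * Dw (p + s' *\<^sub>R v + t' *\<^sub>R w) v"
      using st(3) st'(3) by (simp add: algebra_simps)
    then show "\<exists>s t s' t'. s \<in> {0..\<delta> / Suc n} \<and> t \<in> {0..\<delta> / Suc n}
        \<and> s' \<in> {0..\<delta> / Suc n} \<and> t' \<in> {0..\<delta> / Suc n}
        \<and> Dv (p + s *\<^sub>R v + t *\<^sub>R w) w = Dw (p + s' *\<^sub>R v + t' *\<^sub>R w) v"
      using st st' h unfolding h_def[symmetric] by auto
  qed
  then obtain s t s' t' where
    in_sq: "\<And>n. s n \<in> {0..\<delta> / Suc n}" "\<And>n. t n \<in> {0..\<delta> / Suc n}"
       "\<And>n. s' n \<in> {0..\<delta> / Suc n}" "\<And>n. t' n \<in> {0..\<delta> / Suc n}"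
    and eq: "\<And>n. Dv (p + s n *\<^sub>R v + t n *\<^sub>R w) w = Dw (p + s' n *\<^sub>R v + t' n *\<^sub>R w) v"
    by metis
  have "(\<lambda>n. Dv (p + s n *\<^sub>R v + t n *\<^sub>R w) w) \<longlonglongrightarrow> Dv p w"
    by (rule tendsto_corner_point[where D = "\<lambda>x. Dv x w"])
       (use cont p in_sq S[OF sub[OF in_sq(1)] sub[OF in_sq(2)]] in auto)
  moreover have "(\<lambda>n. Dw (p + s' n *\<^sub>R v + t' n *\<^sub>R w) v) \<longlonglongrightarrow> Dw p v"
    by (rule tendsto_corner_point[where D = "\<lambda>x. Dw x v"])
       (use cont p in_sq S[OF sub[OF in_sq(3)] sub[OF in_sq(4)]] in auto)
  ultimately show ?thesis
    unfolding eq by (rule LIMSEQ_unique)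
qed

section \<open>Partial derivatives on the slab\<close>

text \<open>
  From each point of a nondegenerate slab every coordinate direction can be followed within the
  slab, in at least one of its two senses.
\<close>

lemma slab_derivative_unique:
  assumes T: "T > 0" and p: "p \<in> slab T"
    and "(f has_derivative D) (at p within slab T)" "(f has_derivative D') (at p within slab T)"
  shows "D = D'"
proof (rule frechet_derivative_unique_within[OF assms(3,4)])
  fix i :: point and e :: real
  assume i: "i \<in> Basis" and e: "e > 0"
  \<comment> \<open>The sign makes a time step point towards the middle of the slab, so that it cannot leave the slab.\<close>
  define \<sigma> :: real where "\<sigma> = (if fst p \<le> T / 2 then 1 else -1)"
  define d where "d = \<sigma> * min (e / 2) (T / 2)"
  have "fst i = 0 \<or> fst i = 1"
    using i by (auto simp: Basis_prod_def)
  moreover have "0 \<le> fst p + d" "fst p + d \<le> T"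
    using p T e by (auto simp: d_def \<sigma>_def slab_def min_def)
  ultimately have "p + d *\<^sub>R i \<in> slab T"
    using p by (cases p; cases i) (auto simp: slab_def)
  moreover have "0 < \<bar>d\<bar>" "\<bar>d\<bar> < e"
    using T e by (auto simp: d_def \<sigma>_def min_def)
  ultimately show "\<exists>d. 0 < \<bar>d\<bar> \<and> \<bar>d\<bar> < e \<and> p + d *\<^sub>R i \<in> slab T" by blast
qed

lemma frechet_derivative_slab:
  assumes "T > 0" "p \<in> slab T" "(f has_derivative D) (at p within slab T)"
  shows "frechet_derivative f (at p within slab T) = D"
  using slab_derivative_unique[OF assms(1,2)] assms(3)
  by (metis differentiableI frechet_derivative_works)

lemma Ck_on_slab_bounded_linear:
  assumes T: "T > 0" and L: "bounded_linear L" and "Ck_on k (slab T) f"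
  shows "Ck_on k (slab T) (\<lambda>x. L (f x))"
  using assms(3)
proof (induction k arbitrary: f)
  case 0
  then show ?case by (simp add: bounded_linear.continuous_on[OF L])
next
  case (Suc k)
  have D: "((\<lambda>x. L (f x)) has_derivative (\<lambda>v. L (frechet_derivative f (at x within slab T) v)))
      (at x within slab T)" if "x \<in> slab T" for x
    by (rule bounded_linear.has_derivative[OF L])
       (use Suc.prems that in \<open>simp add: differentiable_on_def frechet_derivative_works\<close>)
  have "Ck_on k (slab T) (\<lambda>x. frechet_derivative (\<lambda>x. L (f x)) (at x within slab T) v)" for v
  proof (subst Ck_on_cong)
    show "frechet_derivative (\<lambda>x. L (f x)) (at y within slab T) v
        = L (frechet_derivative f (at y within slab T) v)" if "y \<in> slab T" for y
      using frechet_derivative_slab[OF T that D[OF that]] by simp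
    show "Ck_on k (slab T) (\<lambda>y. L (frechet_derivative f (at y within slab T) v))"
      using Suc.prems unfolding Ck_on.simps by (intro Suc.IH) blast
  qed
  then show ?case
    using D unfolding Ck_on.simps differentiable_on_def differentiable_def by blast
qed

lemma Ck_on_slab_add:
  assumes T: "T > 0" and "Ck_on k (slab T) f" "Ck_on k (slab T) g"
  shows "Ck_on k (slab T) (\<lambda>x. f x + g x)"
  using assms(2,3)
proof (induction k arbitrary: f g)
  case 0
  then show ?case by (simp add: continuous_on_add)
next
  case (Suc k)
  have D: "((\<lambda>x. f x + g x) has_derivative (\<lambda>v. frechet_derivative f (at x within slab T) v
      + frechet_derivative g (at x within slab T) v)) (at x within slab T)" if "x \<in> slab T" for x
    by (rule has_derivative_add)
       (use Suc.prems that in \<open>simp_all add: differentiable_on_def frechet_derivative_works\<close>)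
  have "Ck_on k (slab T) (\<lambda>x. frechet_derivative (\<lambda>x. f x + g x) (at x within slab T) v)" for v
  proof (subst Ck_on_cong)
    show "frechet_derivative (\<lambda>x. f x + g x) (at y within slab T) v
        = frechet_derivative f (at y within slab T) v + frechet_derivative g (at y within slab T) v"
      if "y \<in> slab T" for y
      using frechet_derivative_slab[OF T that D[OF that]] by simp
    show "Ck_on k (slab T) (\<lambda>y. frechet_derivative f (at y within slab T) v
        + frechet_derivative g (at y within slab T) v)"
      using Suc.prems unfolding Ck_on.simps by (intro Suc.IH) blast+
  qed
  then show ?case
    using D unfolding Ck_on.simps differentiable_on_def differentiable_def by blast
qed

lemma smooth_on_linear_combination:
  fixes f :: "'i \<Rightarrow> point \<Rightarrow> real"
  assumes T: "T > 0" and "finite A" "\<And>i. i \<in> A \<Longrightarrow> smooth_on (slab T) (f i)"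
  shows "smooth_on (slab T) (\<lambda>q. \<Sum>i\<in>A. c i * f i q)"
  using assms(2,3)
proof (induction A rule: finite_induct)
  case empty
  have "Ck_on k (slab T) (\<lambda>q. 0 :: real)" for k
  proof (induction k)
    case (Suc k)
    have "Ck_on k (slab T) (\<lambda>x. frechet_derivative (\<lambda>q. 0 :: real) (at x within slab T) v)
        \<longleftrightarrow> Ck_on k (slab T) (\<lambda>q. 0 :: real)" for v
      by (rule Ck_on_cong) (simp add: frechet_derivative_slab[OF T _ has_derivative_const])
    with Suc show ?case by simp
  qed simp
  then show ?case by (simp add: smooth_on_def)
next
  case (insert i A)
  have "smooth_on (slab T) (\<lambda>q. c i * f i q)"
    using insert.prems Ck_on_slab_bounded_linear[OF T bounded_linear_mult_right]
    unfolding smooth_on_def by blast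
  moreover have "smooth_on (slab T) (\<lambda>q. \<Sum>i\<in>A. c i * f i q)"
    using insert by simp
  ultimately have "smooth_on (slab T) (\<lambda>q. c i * f i q + (\<Sum>i\<in>A. c i * f i q))"
    unfolding smooth_on_def by (intro allI Ck_on_slab_add[OF T]) blast+
  then show ?case using insert.hyps by simp
qed

lemma smooth_on_cmp:
  assumes "T > 0" "smooth_on (slab T) V"
  shows "smooth_on (slab T) (cmp V i)"
  using assms Ck_on_slab_bounded_linear[OF _ bounded_linear_vec_nth]
  unfolding smooth_on_def by blast

lemma smooth_on_pd:
  assumes "smooth_on (slab T) f"
  shows "smooth_on (slab T) (pd T \<alpha> f)"
  unfolding pd_def by (rule smooth_on_frechet_derivative[OF assms])

lemma smooth_on_slab_differentiable:
  assumes "smooth_on (slab T) f" "p \<in> slab T"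
  shows "f differentiable (at p within slab T)"
  using smooth_on_imp_differentiable_on[OF assms(1)] assms(2) by (simp add: differentiable_on_def)

lemma pd_eq:
  assumes "T > 0" "p \<in> slab T" "(f has_derivative D) (at p within slab T)"
  shows "pd T \<alpha> f p = D (coord_vec \<alpha>)"
  unfolding pd_def frechet_derivative_slab[OF assms] ..

lemma pd_cong:
  assumes "\<And>q. q \<in> slab T \<Longrightarrow> f q = g q" "p \<in> slab T"
  shows "pd T \<alpha> f p = pd T \<alpha> g p"
  unfolding pd_def using frechet_derivative_within_cong[OF assms] by simp

context
  fixes T :: real and p :: point
  assumes T: "T > 0" and p: "p \<in> slab T"
begin

lemma has_derivative_slab:
  assumes "f differentiable (at p within slab T)"
  obtains D where "(f has_derivative D) (at p within slab T)" "\<And>\<alpha>. pd T \<alpha> f p = D (coord_vec \<alpha>)"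
  using assms pd_eq[OF T p] unfolding differentiable_def by metis

lemma pd_add:
  assumes "f differentiable (at p within slab T)" "g differentiable (at p within slab T)"
  shows "pd T \<alpha> (\<lambda>q. f q + g q) p = pd T \<alpha> f p + pd T \<alpha> g p"
proof -
  obtain D where D: "(f has_derivative D) (at p within slab T)" "pd T \<alpha> f p = D (coord_vec \<alpha>)"
    using has_derivative_slab[OF assms(1)] by metis
  obtain E where E: "(g has_derivative E) (at p within slab T)" "pd T \<alpha> g p = E (coord_vec \<alpha>)"
    using has_derivative_slab[OF assms(2)] by metis
  show ?thesis
    using pd_eq[OF T p has_derivative_add[OF D(1) E(1)]] D(2) E(2) by simp
qed

lemma pd_mult:
  assumes "f differentiable (at p within slab T)" "g differentiable (at p within slab T)"
  shows "pd T \<alpha> (\<lambda>q. f q * g q) p = pd T \<alpha> f p * g p + f p * pd T \<alpha> g p"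
proof -
  obtain D where D: "(f has_derivative D) (at p within slab T)" "pd T \<alpha> f p = D (coord_vec \<alpha>)"
    using has_derivative_slab[OF assms(1)] by metis
  obtain E where E: "(g has_derivative E) (at p within slab T)" "pd T \<alpha> g p = E (coord_vec \<alpha>)"
    using has_derivative_slab[OF assms(2)] by metis
  show ?thesis
    using pd_eq[OF T p has_derivative_mult[OF D(1) E(1)]] D(2) E(2) by simp
qed

lemma pd_const: "pd T \<alpha> (\<lambda>q. c) p = 0"
  using pd_eq[OF T p has_derivative_const] by simp

lemma pd_cmult:
  assumes "f differentiable (at p within slab T)"
  shows "pd T \<alpha> (\<lambda>q. c * f q) p = c * pd T \<alpha> f p"
  using pd_mult[OF differentiable_const assms] by (simp add: pd_const)

lemma pd_diff:
  assumes "f differentiable (at p within slab T)" "g differentiable (at p within slab T)"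
  shows "pd T \<alpha> (\<lambda>q. f q - g q) p = pd T \<alpha> f p - pd T \<alpha> g p"
  using pd_add[OF assms(1), of "\<lambda>q. -1 * g q"] pd_cmult[OF assms(2), of _ "-1"] assms(2)
  by simp

lemma pd_sum:
  assumes "finite A" "\<And>i. i \<in> A \<Longrightarrow> f i differentiable (at p within slab T)"
  shows "pd T \<alpha> (\<lambda>q. \<Sum>i\<in>A. f i q) p = (\<Sum>i\<in>A. pd T \<alpha> (f i) p)"
  using assms
  by (induction A rule: finite_induct) (simp_all add: pd_const pd_add differentiable_sum)

lemma pd_compose:
  assumes "g differentiable (at (u p))" "u differentiable (at p within slab T)"
  shows "pd T \<alpha> (\<lambda>q. g (u q)) p = deriv g (u p) * pd T \<alpha> u p"
proof -
  obtain D where D: "(u has_derivative D) (at p within slab T)" "pd T \<alpha> u p = D (coord_vec \<alpha>)"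
    using has_derivative_slab[OF assms(2)] by metis
  have "(g has_derivative (*) (deriv g (u p))) (at (u p))"
    using assms(1)
    by (metis DERIV_deriv_iff_real_differentiable has_field_derivative_def)
  from has_derivative_compose[OF D(1) this] show ?thesis
    using pd_eq[OF T p] D(2) by simp
qed

end

text \<open>
  Clairaut's theorem on the closed slab. All coordinate directions are multiplied by a common sign
  \<open>\<sigma>\<close> that makes the time direction point into the slab; the sign enters twice and cancels.
\<close>

lemma pd_commute:
  assumes T: "T > 0" and p: "p \<in> slab T" and f: "smooth_on (slab T) f"
  shows "pd T \<alpha> (pd T \<beta> f) p = pd T \<beta> (pd T \<alpha> f) p"
proof -
  define \<sigma> :: real where "\<sigma> = (if fst p \<le> T / 2 then 1 else -1)"
  let ?D = "\<lambda>f x. frechet_derivative f (at x within slab T)"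
  let ?e = "\<lambda>\<alpha>. \<sigma> *\<^sub>R coord_vec \<alpha>"
  note sm = smooth_on_frechet_derivative[OF f]
  have "?D (\<lambda>x. ?D f x (?e \<beta>)) p (?e \<alpha>) = ?D (\<lambda>x. ?D f x (?e \<alpha>)) p (?e \<beta>)"
    \<comment> \<open>With sides at most \<open>T / 4\<close>, even two time steps cover no more than half of the slab.\<close>
  proof (rule second_derivatives_commute_at_corner[where S = "slab T" and \<delta> = "T / 4" and p = p])
    fix s t assume "s \<in> {0..T / 4}" "t \<in> {0..T / 4}"
    then show "p + s *\<^sub>R ?e \<beta> + t *\<^sub>R ?e \<alpha> \<in> slab T"
      using p by (cases p; cases \<alpha>; cases \<beta>) (auto simp: slab_def \<sigma>_def)
  qed (use T in \<open>auto intro: smooth_on_imp_has_derivative smooth_on_imp_continuous_on sm f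
        smooth_on_frechet_derivative\<close>)
  moreover have "?D (\<lambda>x. ?D f x (?e \<beta>)) p (?e \<alpha>) = pd T \<alpha> (pd T \<beta> f) p" for \<alpha> \<beta>
  proof -
    have lin: "?D g x (?e \<gamma>) = \<sigma> * pd T \<gamma> g x" if "smooth_on (slab T) g" "x \<in> slab T" for g x \<gamma>
      using has_derivative_linear[OF smooth_on_imp_has_derivative[OF that]]
      by (simp add: pd_def linear_cmul)
    have "?D (\<lambda>x. ?D f x (?e \<beta>)) p (?e \<alpha>) = \<sigma> * pd T \<alpha> (\<lambda>x. ?D f x (?e \<beta>)) p"
      by (rule lin[OF sm p])
    also have "\<dots> = \<sigma> * pd T \<alpha> (\<lambda>x. \<sigma> * pd T \<beta> f x) p"
      by (subst pd_cong[OF _ p, where g = "\<lambda>x. \<sigma> * pd T \<beta> f x"]) (auto simp: lin[OF f])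
    also have "\<dots> = \<sigma> * (\<sigma> * pd T \<alpha> (pd T \<beta> f) p)"
      by (subst pd_cmult[OF T p])
         (auto intro: smooth_on_slab_differentiable smooth_on_pd f p)
    also have "\<dots> = pd T \<alpha> (pd T \<beta> f) p" by (simp add: \<sigma>_def)
    finally show ?thesis .
  qed
  ultimately show ?thesis by simp
qed

lemma pd_commute3:
  assumes T: "T > 0" and p: "p \<in> slab T" and f: "smooth_on (slab T) f"
  shows "pd T \<alpha> (pd T \<beta> (pd T \<gamma> f)) p = pd T \<beta> (pd T \<gamma> (pd T \<alpha> f)) p"
proof -
  have "pd T \<alpha> (pd T \<beta> (pd T \<gamma> f)) p = pd T \<beta> (pd T \<alpha> (pd T \<gamma> f)) p"
    by (rule pd_commute[OF T p smooth_on_pd[OF f]])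
  also have "\<dots> = pd T \<beta> (pd T \<gamma> (pd T \<alpha> f)) p"
    by (rule pd_cong[OF _ p]) (rule pd_commute[OF T _ f])
  finally show ?thesis .
qed

lemma pd_pd_linear_combination:
  assumes T: "T > 0" and p: "p \<in> slab T"
    and fin: "finite A" and f: "\<And>i. i \<in> A \<Longrightarrow> smooth_on (slab T) (f i)"
  shows "pd T \<alpha> (pd T \<beta> (\<lambda>q. \<Sum>i\<in>A. c i * f i q)) p
    = (\<Sum>i\<in>A. c i * pd T \<alpha> (pd T \<beta> (f i)) p)"
proof -
  have one: "pd T \<gamma> (\<lambda>q. \<Sum>i\<in>A. c i * g i q) r = (\<Sum>i\<in>A. c i * pd T \<gamma> (g i) r)"
    if "\<And>i. i \<in> A \<Longrightarrow> smooth_on (slab T) (g i)" "r \<in> slab T" for g \<gamma> r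
    using that fin
    by (subst pd_sum[OF T]) (auto intro!: pd_cmult[OF T] sum.cong
        simp: smooth_on_slab_differentiable)
  have "pd T \<alpha> (pd T \<beta> (\<lambda>q. \<Sum>i\<in>A. c i * f i q)) p
      = pd T \<alpha> (\<lambda>q. \<Sum>i\<in>A. c i * pd T \<beta> (f i) q) p"
    by (rule pd_cong[OF one[OF f] p])
  also have "\<dots> = (\<Sum>i\<in>A. c i * pd T \<alpha> (pd T \<beta> (f i)) p)"
    by (rule one[OF smooth_on_pd[OF f] p])
  finally show ?thesis .
qed

section \<open>The d'Alembertian with constant speed\<close>

definition dalembertian :: "real \<Rightarrow> real \<Rightarrow> (point \<Rightarrow> real) \<Rightarrow> point \<Rightarrow> real" where
  "dalembertian T c f p = dt T (dt T f) p - c\<^sup>2 * laplacian T f p"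

lemma dalembertian_cong:
  assumes "\<And>q. q \<in> slab T \<Longrightarrow> f q = g q" "p \<in> slab T"
  shows "dalembertian T c f p = dalembertian T c g p"
proof -
  have "pd T \<alpha> (pd T \<alpha> f) p = pd T \<alpha> (pd T \<alpha> g) p" for \<alpha>
    using assms by (intro pd_cong) auto
  then show ?thesis by (simp add: dalembertian_def laplacian_def)
qed

lemma dalembertian_linear_combination:
  assumes "T > 0" "p \<in> slab T" "finite A" "\<And>i. i \<in> A \<Longrightarrow> smooth_on (slab T) (f i)"
  shows "dalembertian T c (\<lambda>q. \<Sum>i\<in>A. a i * f i q) p = (\<Sum>i\<in>A. a i * dalembertian T c (f i) p)"
proof -
  have "(\<Sum>b\<in>UNIV. \<Sum>i\<in>A. a i * dx T b (dx T b (f i)) p)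
      = (\<Sum>i\<in>A. a i * (\<Sum>b\<in>UNIV. dx T b (dx T b (f i)) p))"
    by (subst sum.swap) (simp add: sum_distrib_left)
  moreover have "pd T \<alpha> (pd T \<alpha> (\<lambda>q. \<Sum>i\<in>A. a i * f i q)) p
      = (\<Sum>i\<in>A. a i * pd T \<alpha> (pd T \<alpha> (f i)) p)" for \<alpha>
    using assms by (rule pd_pd_linear_combination)
  ultimately show ?thesis
    unfolding dalembertian_def laplacian_def
    by (simp add: algebra_simps sum_subtractf sum_distrib_left)
qed

lemma smooth_on_imp_dalembertian_differentiable:
  assumes "smooth_on (slab T) f" "p \<in> slab T"
  shows "dalembertian T c f differentiable (at p within slab T)"
  unfolding dalembertian_def[abs_def] laplacian_def
  by (intro differentiable_diff differentiable_mult differentiable_const differentiable_sum ballI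
      finite smooth_on_slab_differentiable smooth_on_pd assms)

lemma pd_dalembertian:
  assumes T: "T > 0" and p: "p \<in> slab T" and f: "smooth_on (slab T) f"
  shows "pd T \<alpha> (dalembertian T c f) p = dalembertian T c (pd T \<alpha> f) p"
proof -
  have d: "pd T \<beta> (pd T \<beta> f) differentiable (at p within slab T)" for \<beta>
    by (intro smooth_on_slab_differentiable smooth_on_pd f p)
  have "pd T \<alpha> (dalembertian T c f) p
      = pd T \<alpha> (dt T (dt T f)) p - c\<^sup>2 * (\<Sum>b\<in>UNIV. pd T \<alpha> (dx T b (dx T b f)) p)"
    unfolding dalembertian_def[abs_def] laplacian_def
    by (simp add: pd_diff[OF T p] pd_cmult[OF T p] pd_sum[OF T p] d)
  then show ?thesis
    unfolding dalembertian_def laplacian_def by (simp add: pd_commute3[OF T p f])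
qed

section \<open>The two wave operators\<close>

lemma sum_UNIV_option:
  fixes f :: "'a::finite option \<Rightarrow> 'b::comm_monoid_add"
  shows "(\<Sum>\<alpha>\<in>UNIV. f \<alpha>) = f None + (\<Sum>j\<in>UNIV. f (Some j))"
  by (simp add: UNIV_option_conv sum.reindex)

text \<open>
  The factor \<open>\<surd>\<bar>det g\<bar>\<close> is a constant, which can be pulled out of the outer derivative; it is
  nonzero because the metric is nondegenerate, and so cancels against its reciprocal.
\<close>

lemma wave_op_constant_metric:
  assumes T: "T > 0" and p: "p \<in> slab T" and f: "smooth_on (slab T) f"
    and g: "\<And>q. ginv q = A" and A: "invertible A"
  shows "wave_op T ginv f p = hat_wave_op T ginv f p"
proof -
  define \<kappa> where "\<kappa> = sqrt \<bar>det (matrix_inv A)\<bar>"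
  have "A ** matrix_inv A = mat 1"
    using A unfolding invertible_def matrix_inv_def by (rule someI2_ex) simp
  then have "det A * det (matrix_inv A) = 1"
    by (metis det_I det_mul)
  then have \<kappa>: "\<kappa> \<noteq> 0" by (auto simp: \<kappa>_def)
  have d: "pd T \<beta> f differentiable (at p within slab T)" for \<beta>
    by (intro smooth_on_slab_differentiable smooth_on_pd f p)
  have "wave_op T ginv f p
      = 1 / \<kappa> * (\<Sum>\<alpha>\<in>UNIV. \<kappa> * (\<Sum>\<beta>\<in>UNIV. A $ \<alpha> $ \<beta> * pd T \<alpha> (pd T \<beta> f) p))"
    unfolding wave_op_def abs_det_metric_def g \<kappa>_def[symmetric]
    by (simp add: pd_cmult[OF T p] pd_sum[OF T p] d)
  also have "\<dots> = hat_wave_op T ginv f p"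
    using \<kappa> by (simp add: hat_wave_op_def g sum_distrib_left[symmetric])
  finally show ?thesis .
qed

lemma invertible_hE_inv:
  assumes "c > 0"
  shows "invertible (hE_inv c p)"
proof -
  have "det (hE_inv c p) = (\<Prod>\<alpha>\<in>UNIV. hE_inv c p $ \<alpha> $ \<alpha>)"
    by (rule det_diagonal) (auto simp: hE_inv_def split: option.splits)
  also have "\<dots> \<noteq> 0"
    using assms by (auto simp: hE_inv_def split: option.splits)
  finally show ?thesis by (simp add: invertible_det_nz)
qed

lemma hat_wave_op_hE_inv: "hat_wave_op T (hE_inv c) f p = - dalembertian T c f p"
  by (simp add: hat_wave_op_def hE_inv_def sum_UNIV_option dalembertian_def laplacian_def
      sum_distrib_left if_distrib[of "\<lambda>x. x * _"] cong: if_cong)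

text \<open>
  The symmetrised coefficient \<open>\<onehalf> G'(\<partial>\<^sub>jU\<^sup>k) + \<onehalf> G'(\<partial>\<^sub>kU\<^sup>j)\<close> may be replaced by \<open>G'(\<partial>\<^sub>jU\<^sup>k)\<close>, as it
  is contracted with the symmetric Hessian of \<open>f\<close>.
\<close>

lemma hat_wave_op_gE_inv:
  assumes "T > 0" "p \<in> slab T" "smooth_on (slab T) f"
  shows "hat_wave_op T (gE_inv T c G' \<phi> \<psi>) f p = - dalembertian T c f p
    + (\<Sum>j\<in>UNIV. \<Sum>k\<in>UNIV. G' j k (dU T \<phi> \<psi> j k p) * dx T j (dx T k f) p)"
proof -
  let ?g = "\<lambda>j k. G' j k (dU T \<phi> \<psi> j k p)" and ?H = "\<lambda>j k. dx T j (dx T k f) p"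
  have "(\<Sum>j\<in>UNIV. \<Sum>k\<in>UNIV. ?g k j * ?H j k) = (\<Sum>j\<in>UNIV. \<Sum>k\<in>UNIV. ?g j k * ?H j k)"
    by (subst sum.swap) (simp add: pd_commute[OF assms])
  then have "(\<Sum>j\<in>UNIV. \<Sum>k\<in>UNIV. (1/2 * ?g j k + 1/2 * ?g k j) * ?H j k)
      = (\<Sum>j\<in>UNIV. \<Sum>k\<in>UNIV. ?g j k * ?H j k)"
    by (simp add: algebra_simps sum.distrib flip: sum_divide_distrib)
  moreover have "(\<Sum>j\<in>UNIV. \<Sum>k\<in>UNIV. (if j = k then c\<^sup>2 else 0) * ?H j k)
      = c\<^sup>2 * laplacian T f p"
    by (simp add: laplacian_def sum_distrib_left if_distrib[of "\<lambda>x. x * _"] cong: if_cong)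
  ultimately show ?thesis
    by (simp add: hat_wave_op_def gE_inv_def sum_UNIV_option dalembertian_def
        distrib_right sum.distrib)
qed

section \<open>Differentiating the elastic wave equation\<close>

text \<open>
  Indexing by pairs makes a component of the curl a single finite linear combination, the form in
  which smoothness and the d'Alembertian of sums are available.
\<close>

lemma curl_cmp_eq:
  "cmp (curl T \<psi>) i q = (\<Sum>ab\<in>UNIV. levi_civita i (fst ab) (snd ab) * dx T (fst ab) (cmp \<psi> (snd ab)) q)"
  by (simp add: curl_def sum.cartesian_product case_prod_beta)

lemma levi_civita_swap: "levi_civita i b a = - levi_civita i a b"
proof -
  have "(1::3) \<noteq> 2" "(1::3) \<noteq> 3" "(2::3) \<noteq> 3" by simp_all
  then have disjoint: "\<not> ((i, a, b) \<in> {(3, 2, 1), (2, 1, 3), (1, 3, 2)}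
      \<and> (i, a, b) \<in> {(1, 2, 3), (2, 3, 1), (3, 1, 2)})"
    unfolding insert_iff empty_iff prod.inject by metis
  have swap: "(i, b, a) \<in> {(1, 2, 3), (2, 3, 1), (3, 1, 2)}
      \<longleftrightarrow> (i, a, b) \<in> {(3, 2, 1), (2, 1, 3), (1, 3, 2)}"
    "(i, b, a) \<in> {(3, 2, 1), (2, 1, 3), (1, 3, 2)}
      \<longleftrightarrow> (i, a, b) \<in> {(1, 2, 3), (2, 3, 1), (3, 1, 2)}" by blast+
  have "(if P then 1 else if Q then -1 else 0) = - (if Q then 1 else if P then -1 else (0::real))"
    if "\<not> (P \<and> Q)" for P Q
    using that by simp
  from this[OF disjoint] show ?thesis
    unfolding levi_civita_def swap .
qed

lemma levi_civita_contract_symmetric: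
  assumes "\<And>a b. B a b = B b a"
  shows "(\<Sum>ab\<in>UNIV. levi_civita i (fst ab) (snd ab) * B (fst ab) (snd ab)) = 0"
proof -
  let ?s = "\<Sum>a\<in>UNIV. \<Sum>b\<in>UNIV. levi_civita i a b * B a b"
  have "?s = (\<Sum>b\<in>UNIV. \<Sum>a\<in>UNIV. levi_civita i a b * B a b)"
    by (rule sum.swap)
  also have "\<dots> = (\<Sum>b\<in>UNIV. \<Sum>a\<in>UNIV. - (levi_civita i b a * B b a))"
    by (intro sum.cong refl) (metis assms levi_civita_swap mult_minus_left)
  also have "\<dots> = - ?s" by (simp add: sum_negf)
  finally show ?thesis
    by (simp add: sum.cartesian_product case_prod_beta)
qed

text \<open>
  The chain and product rules for the right-hand side. Up to the order of differentiation the
  result is symmetric in \<open>a\<close> and \<open>i\<close>; its antisymmetric part and its trace are the curl and the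
  divergence of the equation.
\<close>

lemma differentiated_wave_equation:
  assumes T: "T > 0" and p: "p \<in> slab T"
    and G': "\<And>j k. smooth_on UNIV (G' j k)"
    and \<phi>: "smooth_on (slab T) \<phi>" and \<psi>: "smooth_on (slab T) \<psi>"
    and wave_eq: "\<And>q. q \<in> slab T \<Longrightarrow>
      dalembertian T c\<^sub>1 (cmp \<phi> i) q + dalembertian T c\<^sub>2 (cmp \<psi> i) q
      = (\<Sum>j\<in>UNIV. \<Sum>k\<in>UNIV. G' j k (dU T \<phi> \<psi> j k q)
           * (dx T i (dx T j (cmp \<phi> k)) q + dx T i (dx T j (cmp \<psi> k)) q))"
  shows "dalembertian T c\<^sub>1 (dx T a (cmp \<phi> i)) p + dalembertian T c\<^sub>2 (dx T a (cmp \<psi> i)) p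
      = (\<Sum>j\<in>UNIV. \<Sum>k\<in>UNIV.
           deriv (G' j k) (dU T \<phi> \<psi> j k p)
             * ((dx T a (dx T j (cmp \<phi> k)) p + dx T a (dx T j (cmp \<psi> k)) p)
              * (dx T i (dx T j (cmp \<phi> k)) p + dx T i (dx T j (cmp \<psi> k)) p))
         + G' j k (dU T \<phi> \<psi> j k p)
             * (dx T a (dx T i (dx T j (cmp \<phi> k))) p + dx T a (dx T i (dx T j (cmp \<psi> k))) p))"
proof -
  note cmp = smooth_on_cmp[OF T \<phi>] smooth_on_cmp[OF T \<psi>]
  note diff = smooth_on_slab_differentiable[OF _ p]
  have d1: "dx T j (cmp \<phi> k) differentiable (at p within slab T)"
    "dx T j (cmp \<psi> k) differentiable (at p within slab T)" for j k
    by (intro diff smooth_on_pd cmp)+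
  have d2: "dx T i (dx T j (cmp \<phi> k)) differentiable (at p within slab T)"
    "dx T i (dx T j (cmp \<psi> k)) differentiable (at p within slab T)" for j k
    by (intro diff smooth_on_pd cmp)+
  have dg: "G' j k differentiable (at x)" for j k x
    using smooth_on_imp_differentiable_on[OF G'] by (simp add: differentiable_on_def)
  have du: "dU T \<phi> \<psi> j k differentiable (at p within slab T)" for j k
    unfolding dU_def[abs_def] by (intro differentiable_add d1)
  have dgu: "(\<lambda>q. G' j k (dU T \<phi> \<psi> j k q)) differentiable (at p within slab T)" for j k
    using differentiable_compose[OF dg du] .
  have pd_u: "dx T a (dU T \<phi> \<psi> j k) p = dx T a (dx T j (cmp \<phi> k)) p + dx T a (dx T j (cmp \<psi> k)) p"
    for j k
    unfolding dU_def[abs_def] by (rule pd_add[OF T p d1])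
  have "dalembertian T c\<^sub>1 (dx T a (cmp \<phi> i)) p + dalembertian T c\<^sub>2 (dx T a (cmp \<psi> i)) p
      = dx T a (\<lambda>q. dalembertian T c\<^sub>1 (cmp \<phi> i) q + dalembertian T c\<^sub>2 (cmp \<psi> i) q) p"
    by (simp add: pd_add[OF T p] smooth_on_imp_dalembertian_differentiable[OF _ p] cmp
        pd_dalembertian[OF T p])
  also have "\<dots> = dx T a (\<lambda>q. \<Sum>j\<in>UNIV. \<Sum>k\<in>UNIV. G' j k (dU T \<phi> \<psi> j k q)
      * (dx T i (dx T j (cmp \<phi> k)) q + dx T i (dx T j (cmp \<psi> k)) q)) p"
    by (rule pd_cong[OF wave_eq p])
  also have "\<dots> = (\<Sum>j\<in>UNIV. \<Sum>k\<in>UNIV.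
      deriv (G' j k) (dU T \<phi> \<psi> j k p) * dx T a (dU T \<phi> \<psi> j k) p
        * (dx T i (dx T j (cmp \<phi> k)) p + dx T i (dx T j (cmp \<psi> k)) p)
      + G' j k (dU T \<phi> \<psi> j k p)
        * (dx T a (dx T i (dx T j (cmp \<phi> k))) p + dx T a (dx T i (dx T j (cmp \<psi> k))) p))"
    by (simp add: pd_sum[OF T p] pd_mult[OF T p dgu] pd_add[OF T p d2] pd_compose[OF T p dg du]
        differentiable_mult differentiable_add differentiable_sum dgu d2)
  finally show ?thesis by (simp add: pd_u mult.assoc)
qed

lemma pd_gradient_symmetric:
  assumes T: "T > 0" and p: "p \<in> slab T" and "smooth_on (slab T) f"
    and grad: "\<And>q i. q \<in> slab T \<Longrightarrow> \<phi> q $ i = dx T i f q"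
  shows "dx T a (cmp \<phi> b) p = dx T b (cmp \<phi> a) p"
proof -
  have "dx T a (cmp \<phi> b) p = dx T a (dx T b f) p"
    by (rule pd_cong[OF grad p])
  also have "\<dots> = dx T b (dx T a f) p"
    by (rule pd_commute) (use assms in auto)
  also have "\<dots> = dx T b (cmp \<phi> a) p"
    by (rule pd_cong[OF grad[symmetric] p])
  finally show ?thesis .
qed

section \<open>The equations for the divergence and the curl\<close>

theorem proposition3p1:
  fixes T c\<^sub>1 c\<^sub>2 :: real
    and G :: "real ^ 3 ^ 3 \<Rightarrow> real"
    and G' :: "3 \<Rightarrow> 3 \<Rightarrow> real \<Rightarrow> real"
    and \<phi>pot :: "point \<Rightarrow> real"
    and \<phi> \<psi> :: "point \<Rightarrow> real ^ 3"
  assumes T: "T > 0"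
    and c: "c\<^sub>1 > c\<^sub>2" "c\<^sub>2 > 0"
    and G_smooth: "smooth_on UNIV G"
    and G'_smooth: "\<And>j k. smooth_on UNIV (G' j k)"
    and G': "\<And>j k M. frechet_derivative G (at M) (axis j (axis k 1)) = G' j k (M $ j $ k)"
    and \<phi>pot_smooth: "smooth_on (slab T) \<phi>pot"
    and \<phi>_smooth: "smooth_on (slab T) \<phi>"
    and \<psi>_smooth: "smooth_on (slab T) \<psi>"
    and \<phi>_grad: "\<And>p i. p \<in> slab T \<Longrightarrow> \<phi> p $ i = dx T i \<phi>pot p"
    and \<psi>_div: "\<And>p. p \<in> slab T \<Longrightarrow> divergence T \<psi> p = 0"
    and wave_eq: "\<And>p i. p \<in> slab T \<Longrightarrow>
      (dt T (dt T (cmp \<phi> i)) p - c\<^sub>1\<^sup>2 * laplacian T (cmp \<phi> i) p)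
      + (dt T (dt T (cmp \<psi> i)) p - c\<^sub>2\<^sup>2 * laplacian T (cmp \<psi> i) p)
      = (\<Sum>j\<in>UNIV. \<Sum>k\<in>UNIV.
           G' j k (dx T j (cmp \<phi> k) p + dx T j (cmp \<psi> k) p)
           * (dx T i (dx T j (cmp \<phi> k)) p + dx T i (dx T j (cmp \<psi> k)) p))"
  shows "(\<forall>p\<in>slab T.
            hat_wave_op T (gE_inv T c\<^sub>1 G' \<phi> \<psi>) (divergence T \<phi>) p = P_div T G' \<phi> \<psi> p)
       \<and> (\<forall>p\<in>slab T. \<forall>i. wave_op T (hE_inv c\<^sub>2) (cmp (curl T \<psi>) i) p = 0)"
proof (intro conjI ballI allI)
  note sm\<phi> = smooth_on_cmp[OF T \<phi>_smooth] and sm\<psi> = smooth_on_cmp[OF T \<psi>_smooth]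
  note grad_sym = pd_gradient_symmetric[OF T _ \<phi>pot_smooth \<phi>_grad]
  have wave: "dalembertian T c\<^sub>1 (cmp \<phi> i) q + dalembertian T c\<^sub>2 (cmp \<psi> i) q
      = (\<Sum>j\<in>UNIV. \<Sum>k\<in>UNIV. G' j k (dU T \<phi> \<psi> j k q)
           * (dx T i (dx T j (cmp \<phi> k)) q + dx T i (dx T j (cmp \<psi> k)) q))"
    if "q \<in> slab T" for i q
    using wave_eq[OF that] by (simp add: dalembertian_def dU_def)
  note dwave = differentiated_wave_equation[OF T _ G'_smooth \<phi>_smooth \<psi>_smooth wave]
  have div_eq: "divergence T V q = (\<Sum>i\<in>UNIV. 1 * dx T i (cmp V i) q)" for V q
    by (simp add: divergence_def)

  fix p assume p: "p \<in> slab T"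
  let ?E = "\<lambda>i j k. dx T i (dx T j (cmp \<phi> k)) p + dx T i (dx T j (cmp \<psi> k)) p"
  let ?g = "\<lambda>j k. G' j k (dU T \<phi> \<psi> j k p)"
    and ?dg = "\<lambda>j k. deriv (G' j k) (dU T \<phi> \<psi> j k p)"
  have dal_div: "dalembertian T c (divergence T V) p = (\<Sum>i\<in>UNIV. dalembertian T c (dx T i (cmp V i)) p)"
    if "smooth_on (slab T) V" for c V
    unfolding div_eq[abs_def]
    by (subst dalembertian_linear_combination[OF T p])
       (auto intro: smooth_on_pd smooth_on_cmp[OF T that])
  \<comment> \<open>As \<open>\<partial>\<^sub>i\<phi>\<^sup>k = \<partial>\<^sub>k\<phi>\<^sup>i\<close>, one of the two contracted derivatives turns into a divergence.\<close>
  have lap_\<phi>: "laplacian T (dx T j (cmp \<phi> k)) p = dx T j (dx T k (divergence T \<phi>)) p" for j k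
  proof -
    have "dx T i (dx T i (dx T j (cmp \<phi> k))) p = dx T j (dx T k (dx T i (cmp \<phi> i))) p" for i
    proof -
      have "dx T i (dx T i (dx T j (cmp \<phi> k))) p = dx T j (dx T i (dx T i (cmp \<phi> k))) p"
        by (rule pd_commute3[OF T p sm\<phi>, symmetric])
      also have "\<dots> = dx T j (dx T i (dx T k (cmp \<phi> i))) p"
        by (intro pd_cong p grad_sym)
      also have "\<dots> = dx T j (dx T k (dx T i (cmp \<phi> i))) p"
        by (rule pd_cong[OF _ p]) (rule pd_commute[OF T _ sm\<phi>])
      finally show ?thesis .
    qed
    then show ?thesis
      unfolding laplacian_def div_eq[abs_def]
      by (subst pd_pd_linear_combination[OF T p]) (auto intro: smooth_on_pd sm\<phi>)
  qed

  have sm_div: "smooth_on (slab T) (divergence T \<phi>)"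
    unfolding div_eq[abs_def] by (intro smooth_on_linear_combination T smooth_on_pd sm\<phi>) simp
  show "hat_wave_op T (gE_inv T c\<^sub>1 G' \<phi> \<psi>) (divergence T \<phi>) p = P_div T G' \<phi> \<psi> p"
  proof -
    have "dalembertian T c\<^sub>2 (divergence T \<psi>) p = dalembertian T c\<^sub>2 (\<lambda>q. 0) p"
      by (rule dalembertian_cong[OF \<psi>_div p])
    also have "\<dots> = 0"
      using dalembertian_linear_combination[OF T p finite.emptyI] by simp
    finally have "dalembertian T c\<^sub>1 (divergence T \<phi>) p
      = dalembertian T c\<^sub>1 (divergence T \<phi>) p + dalembertian T c\<^sub>2 (divergence T \<psi>) p" by simp
    also have "\<dots> = (\<Sum>i\<in>UNIV. \<Sum>j\<in>UNIV. \<Sum>k\<in>UNIV. ?dg j k * (?E i j k)\<^sup>2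
        + ?g j k * (dx T i (dx T i (dx T j (cmp \<phi> k))) p + dx T i (dx T i (dx T j (cmp \<psi> k))) p))"
      unfolding dal_div[OF \<phi>_smooth] dal_div[OF \<psi>_smooth]
      by (simp add: dwave[OF p] power2_eq_square flip: sum.distrib)
    also have "\<dots> = (\<Sum>i\<in>UNIV. \<Sum>j\<in>UNIV. \<Sum>k\<in>UNIV. ?dg j k * (?E i j k)\<^sup>2)
        + (\<Sum>j\<in>UNIV. \<Sum>k\<in>UNIV. ?g j k
            * (laplacian T (dx T j (cmp \<phi> k)) p + laplacian T (dx T j (cmp \<psi> k)) p))"
    proof -
      have "(\<Sum>i\<in>UNIV. \<Sum>j\<in>UNIV. \<Sum>k\<in>UNIV. ?g j k * X i j k)
          = (\<Sum>j\<in>UNIV. \<Sum>k\<in>UNIV. ?g j k * (\<Sum>i\<in>UNIV. X i j k))" for X :: "3 \<Rightarrow> 3 \<Rightarrow> 3 \<Rightarrow> real"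
        unfolding sum_distrib_left
        by (subst sum.swap, rule sum.cong[OF refl], rule sum.swap)
      then show ?thesis
        by (simp only: laplacian_def sum.distrib[symmetric]) (simp add: sum.distrib)
    qed
    also have "\<dots> = (\<Sum>j\<in>UNIV. \<Sum>k\<in>UNIV. ?g j k * dx T j (dx T k (divergence T \<phi>)) p)
        - P_div T G' \<phi> \<psi> p"
      by (simp add: lap_\<phi> P_div_def distrib_left sum.distrib)
    finally show ?thesis
      by (simp add: hat_wave_op_gE_inv[OF T p sm_div])
  qed

  fix i
  have sm_curl: "smooth_on (slab T) (cmp (curl T \<psi>) i)"
    unfolding curl_cmp_eq by (intro smooth_on_linear_combination T smooth_on_pd sm\<psi>) simp
  have "dalembertian T c\<^sub>2 (dx T a (cmp \<psi> b)) p = dalembertian T c\<^sub>2 (dx T b (cmp \<psi> a)) p" for a b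
  proof -
    have "dalembertian T c\<^sub>1 (dx T a (cmp \<phi> b)) p = dalembertian T c\<^sub>1 (dx T b (cmp \<phi> a)) p"
      by (rule dalembertian_cong[OF grad_sym p])
    moreover have "dalembertian T c\<^sub>1 (dx T a (cmp \<phi> b)) p + dalembertian T c\<^sub>2 (dx T a (cmp \<psi> b)) p
        = dalembertian T c\<^sub>1 (dx T b (cmp \<phi> a)) p + dalembertian T c\<^sub>2 (dx T b (cmp \<psi> a)) p"
      by (simp add: dwave[OF p] mult.commute
          pd_commute[OF T p smooth_on_pd[OF sm\<phi>], of "Some a" "Some b"]
          pd_commute[OF T p smooth_on_pd[OF sm\<psi>], of "Some a" "Some b"])
    ultimately show ?thesis by simp
  qed
  then have "dalembertian T c\<^sub>2 (cmp (curl T \<psi>) i) p = 0"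
    unfolding curl_cmp_eq
    by (subst dalembertian_linear_combination[OF T p])
       (auto intro: smooth_on_pd sm\<psi> levi_civita_contract_symmetric)
  then show "wave_op T (hE_inv c\<^sub>2) (cmp (curl T \<psi>) i) p = 0"
    by (subst wave_op_constant_metric[OF T p sm_curl, where A = "hE_inv c\<^sub>2 p"])
       (simp_all add: invertible_hE_inv[OF c(2)] hat_wave_op_hE_inv, simp add: hE_inv_def)
qed

end
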